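(* For all positive integers $k\leq n$ and every $\tau\in T_k^k$, $$|S_n(T_k^k;\tau)|=(n+1-k)\cdot(k-1)^{n-k}.$$
   Context: $S_n$ denotes the set of all permutations $\alpha=(\alpha_1,\dots,\alpha_n)$ of $\{1,\dots,n\}$, written in one-line notation. For $1\leq m\leq k$, $T_k^m=\{\sigma\in S_k\mid\sigma_1=m\}$ is the set of permutations of $\{1,\dots,k\}$ whose first entry is $m$. An occurrence of a pattern $\tau\in S_k$ in $\alpha\in S_n$ is a choice of indices $1\leq i_1<\dots<i_k\leq n$ such that $(\alpha_{i_1},\dots,\alpha_{i_k})$ is order-isomorphic to $(\tau_1,\dots,\tau_k)$ (i.e. $\alpha_{i_a}<\alpha_{i_b}$ if and only if $\tau_a<\tau_b$). The permutation $\alpha$ avoids $\tau$ if it has no occurrence of $\tau$, and contains $\tau$ exactly once if it has exactly one occurrence of $\tau$. For $\tau\in T_k^m$, $S_n(T_k^m;\tau)$ denotes the set of all permutations in $S_n$ that avoid every pattern in $T_k^m\setminus\{\tau\}$ and contain $\tau$ exactly once. The convention $0^0=1$ is used. *)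

theory Defs
  imports Main "HOL-Combinatorics.Multiset_Permutations"
begin

(* One-line notation: alpha_i (1 <= i <= n) is the list entry alpha ! (i - 1). *)

definition perms :: "nat \<Rightarrow> nat list set" where
  "perms n = permutations_of_set {1..n}"

definition perms_fst :: "nat \<Rightarrow> nat \<Rightarrow> nat list set" where
  "perms_fst k m = {\<sigma> \<in> perms k. \<sigma> ! 0 = m}"

(* An occurrence i_1 < ... < i_k is the list of its indices, which are shifted down by one
   since list positions start at 0. *)
definition occurrences :: "nat list \<Rightarrow> nat list \<Rightarrow> nat list set" where
  "occurrences \<tau> \<alpha> =
    {is. length is = length \<tau> \<and> sorted_wrt (<) is \<and> set is \<subseteq> {..<length \<alpha>} \<and>
      (\<forall>a<length \<tau>. \<forall>b<length \<tau>. \<alpha> ! (is ! a) < \<alpha> ! (is ! b) \<longleftrightarrow> \<tau> ! a < \<tau> ! b)}"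

definition avoids :: "nat list \<Rightarrow> nat list \<Rightarrow> bool" where
  "avoids \<alpha> \<tau> \<longleftrightarrow> occurrences \<tau> \<alpha> = {}"

definition contains_once :: "nat list \<Rightarrow> nat list \<Rightarrow> bool" where
  "contains_once \<alpha> \<tau> \<longleftrightarrow> (\<exists>!is. is \<in> occurrences \<tau> \<alpha>)"

(* In S_n(T; tau) the pattern tau itself is exempt from avoidance. *)
definition avoid_except_once :: "nat \<Rightarrow> nat list set \<Rightarrow> nat list \<Rightarrow> nat list set" where
  "avoid_except_once n T \<tau> =
    {\<alpha> \<in> perms n. (\<forall>\<sigma> \<in> T - {\<tau>}. avoids \<alpha> \<sigma>) \<and> contains_once \<alpha> \<tau>}"

end

theory Submission
  imports Defs
begin

text \<open>
Put \<open>d = k - 1\<close>. An occurrence of some pattern of \<open>k\<close> letters that starts with \<open>k\<close> is the choice of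
an entry \<open>x\<close> together with \<open>d\<close> later entries smaller than \<open>x\<close>. An entry with \<open>r\<close> later smaller
entries therefore starts \<open>r choose d\<close> such occurrences. Since each occurrence belongs to exactly
one pattern, containing \<open>\<tau>\<close> once and no other pattern means that there is only one occurrence
altogether, and that it spells \<open>\<tau>\<close>: one entry has exactly \<open>d\<close> later smaller entries, which are
ordered like the tail \<open>\<rho>\<close> of \<open>\<tau>\<close>, and all other entries have fewer than \<open>d\<close>
(\<open>avoids_others_contains_once_iff\<close> and \<open>max_led_singleton_iff\<close>).

These permutations are counted by removing the first entry (\<open>card_single_excess\<close>). The number of
entries smaller than the first can be anything from \<open>0\<close> to \<open>n - 1\<close>. If it is less than \<open>d\<close>, what
remains is a permutation of the same kind. If it is \<open>d\<close>, then in what remains every entry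
has fewer than \<open>d\<close> later smaller entries, and the \<open>d\<close> smallest entries occur in one prescribed
order. There are \<open>d ^ (n - 1 - d)\<close> permutations of the latter sort (\<open>card_few_later_smaller\<close>): one
starts with the \<open>d\<close> smallest values in the prescribed order and inserts the others in increasing
order; each has exactly \<open>d\<close> admissible places, those with fewer than \<open>d\<close> entries to their
right, and it leaves the counts of all smaller entries unchanged. Hence
\<open>F n = d * F (n - 1) + d ^ (n - 1 - d)\<close> for \<open>n > d\<close>, with \<open>F d = 0\<close>, which gives
\<open>F n = (n - d) * d ^ (n - 1 - d)\<close>.

The counts are made for permutations of arbitrary finite linearly ordered sets, so that removing
or inserting an entry needs no renumbering of the others.
\<close>

section \<open>Ranks and order isomorphism\<close>

definition rank :: "'a::linorder set \<Rightarrow> 'a \<Rightarrow> nat" where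
  "rank S x = card {y \<in> S. y < x}"

definition order_iso :: "'a::linorder list \<Rightarrow> 'b::linorder list \<Rightarrow> bool" where
  "order_iso xs ys \<longleftrightarrow> length xs = length ys \<and>
    (\<forall>a<length ys. \<forall>b<length ys. xs ! a < xs ! b \<longleftrightarrow> ys ! a < ys ! b)"

lemma rank_less_iff:
  assumes "finite S" "x \<in> S" "y \<in> S"
  shows "rank S x < rank S y \<longleftrightarrow> x < y"
proof -
  have "rank S u < rank S v" if "u < v" "u \<in> S" for u v
    unfolding rank_def using that assms(1) by (intro psubset_card_mono) auto
  then show ?thesis
    using assms by (metis less_asym linorder_neqE)
qed

lemma inj_on_rank: "finite S \<Longrightarrow> inj_on (rank S) S"
  by (rule inj_onI) (metis less_irrefl linorder_neqE rank_less_iff)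

lemma bij_betw_rank:
  assumes "finite S"
  shows "bij_betw (rank S) S {..<card S}"
proof -
  have "rank S ` S \<subseteq> {..<card S}"
    unfolding rank_def using assms by (auto intro!: psubset_card_mono)
  moreover have "card (rank S ` S) = card {..<card S}"
    using inj_on_rank[OF assms] by (simp add: card_image)
  ultimately have "rank S ` S = {..<card S}"
    by (simp add: card_subset_eq)
  then show ?thesis
    using inj_on_rank[OF assms] by (simp add: bij_betw_def)
qed

text \<open>The word of ranks is a normal form for order isomorphism. One direction holds because the rank of
an entry is the number of positions that carry a smaller entry, which depends only on the
comparisons; the other because ranks compare like the entries themselves.\<close>

lemma order_iso_iff_map_rank_eq:
  assumes "distinct xs" "distinct ys"
  shows "order_iso xs ys \<longleftrightarrow> map (rank (set xs)) xs = map (rank (set ys)) ys"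
proof
  have rank_nth: "rank (set zs) (zs ! a) = card {b. b < length zs \<and> zs ! b < zs ! a}"
    if "distinct zs" for zs :: "'c::linorder list" and a
  proof -
    have "{y \<in> set zs. y < zs ! a} = (!) zs ` {b. b < length zs \<and> zs ! b < zs ! a}"
      by (auto simp: in_set_conv_nth)
    moreover have "inj_on ((!) zs) {b. b < length zs \<and> zs ! b < zs ! a}"
      using that by (auto simp: inj_on_def nth_eq_iff_index_eq)
    ultimately show ?thesis
      by (simp add: rank_def card_image)
  qed
  assume iso: "order_iso xs ys"
  then have len: "length xs = length ys"
    by (simp add: order_iso_def)
  show "map (rank (set xs)) xs = map (rank (set ys)) ys"
  proof (rule nth_equalityI)
    fix a assume "a < length (map (rank (set xs)) xs)"
    then have a: "a < length xs" by simp
    have "{b. b < length xs \<and> xs ! b < xs ! a} = {b. b < length ys \<and> ys ! b < ys ! a}"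
      using iso a len by (auto simp: order_iso_def)
    then show "map (rank (set xs)) xs ! a = map (rank (set ys)) ys ! a"
      using a len assms by (simp add: rank_nth)
  qed (simp add: len)
next
  assume eq: "map (rank (set xs)) xs = map (rank (set ys)) ys"
  then have len: "length xs = length ys"
    by (rule map_eq_imp_length_eq)
  have "rank (set xs) (xs ! a) = rank (set ys) (ys ! a)" if "a < length ys" for a
    using arg_cong[OF eq, of "\<lambda>zs. zs ! a"] that len by simp
  then show "order_iso xs ys"
    unfolding order_iso_def using len
    by (metis List.finite_set nth_mem rank_less_iff)
qed

text \<open>Standardisation: the pattern of a word can be spelled in exactly one way with any given set of as
many letters. The spelling replaces each entry by the letter of the same rank.\<close>

lemma ex1_permutation_order_iso:
  assumes "finite S" "distinct xs" "card S = length xs"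
  shows "\<exists>!ys. ys \<in> permutations_of_set S \<and> order_iso ys xs"
proof -
  define h where "h = the_inv_into S (rank S)"
  define zs where "zs = map (rank (set xs)) xs"
  have bij: "bij_betw (rank S) S {..<card S}"
    by (rule bij_betw_rank[OF assms(1)])
  have zs_set: "set zs = {..<card S}"
    using bij_betw_rank[of "set xs"] assms by (simp add: zs_def bij_betw_def distinct_card)
  have zs_distinct: "distinct zs"
    using assms(2) inj_on_rank[of "set xs"] by (simp add: zs_def distinct_map)
  have bij_h: "bij_betw h {..<card S} S"
    unfolding h_def by (rule bij_betw_the_inv_into[OF bij])
  have mem: "map h zs \<in> permutations_of_set S"
    using bij_h zs_set zs_distinct
    by (auto simp: permutations_of_set_def distinct_map bij_betw_def)
  have rank_h: "rank S (h z) = z" if "z < card S" for z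
    unfolding h_def using bij that by (intro f_the_inv_into_f_bij_betw) auto
  have iso_iff: "order_iso ys xs \<longleftrightarrow> map (rank S) ys = zs" if "ys \<in> permutations_of_set S" for ys
    using that assms(2) by (auto simp: permutations_of_set_def order_iso_iff_map_rank_eq zs_def)
  have "map (rank S) (map h zs) = zs"
    unfolding map_map by (rule map_idI) (use zs_set rank_h in auto)
  moreover have "ys = map h zs"
    if "ys \<in> permutations_of_set S" "map (rank S) ys = zs" for ys
    using that mem calculation inj_on_rank[OF assms(1)]
    by (intro map_inj_on[of "rank S"]) (auto simp: permutations_of_set_def)
  ultimately show ?thesis
    using mem iso_iff by blast
qed

lemma order_iso_Cons_max:
  assumes "\<forall>y\<in>set xs. y < x" "\<forall>z\<in>set ys. z < y"
  shows "order_iso (x # xs) (y # ys) \<longleftrightarrow> order_iso xs ys"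
proof -
  have "xs ! a < x" "\<not> x < xs ! a" if "a < length xs" for a
    using assms(1) nth_mem[OF that] by (blast, blast dest: order.asym)
  moreover have "ys ! a < y" "\<not> y < ys ! a" if "a < length ys" for a
    using assms(2) nth_mem[OF that] by (blast, blast dest: order.asym)
  ultimately show ?thesis
    by (auto simp: order_iso_def All_less_Suc2)
qed


section \<open>Counting by the number of later smaller entries\<close>

fun few_later_smaller :: "nat \<Rightarrow> 'a::linorder list \<Rightarrow> bool" where
  "few_later_smaller d [] = True"
| "few_later_smaller d (x # xs) =
    (length (filter (\<lambda>y. y < x) xs) < d \<and> few_later_smaller d xs)"

text \<open>Read from the left: the entries before the distinguished one stay below the bound \<open>d\<close>, the
distinguished one meets it and its later smaller entries have the pattern \<open>\<rho>\<close>, and those behind it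
stay below again.\<close>

fun single_excess :: "nat \<Rightarrow> 'b::linorder list \<Rightarrow> 'a::linorder list \<Rightarrow> bool" where
  "single_excess d \<rho> [] = False"
| "single_excess d \<rho> (x # xs) =
    ((length (filter (\<lambda>y. y < x) xs) < d \<and> single_excess d \<rho> xs) \<or>
     (length (filter (\<lambda>y. y < x) xs) = d \<and> few_later_smaller d xs \<and>
        order_iso (filter (\<lambda>y. y < x) xs) \<rho>))"

lemma few_later_smaller_if_short: "length xs \<le> d \<Longrightarrow> few_later_smaller d xs"
  by (induction xs) (auto intro: le_less_trans[OF length_filter_le])

text \<open>A maximum is larger than everything behind it, so that its own count is the length of the rest,
and it is never one of the smaller entries counted for another entry.\<close>

lemma few_later_smaller_insert_max:
  assumes "\<forall>y\<in>set us \<union> set vs. y < b"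
  shows "few_later_smaller d (us @ b # vs) \<longleftrightarrow> few_later_smaller d (us @ vs) \<and> length vs < d"
  using assms
proof (induction us)
  case Nil
  then show ?case by (auto simp: filter_id_conv)
next
  case (Cons u us)
  then show ?case by (auto simp: not_less_iff_gr_or_eq)
qed

text \<open>Induction over the elements of \<open>T\<close> in increasing order. A new maximum can go to any place with fewer
than \<open>d\<close> entries to its right. There are exactly \<open>d\<close> such places, since at least the \<open>d\<close>
elements of \<open>L\<close> are already there, and the order of \<open>L\<close> is not affected.\<close>

lemma card_few_later_smaller:
  fixes L T :: "'a::linorder set"
  assumes "finite T" "finite L" "card L = d" "\<forall>x\<in>L. \<forall>y\<in>T. x < y" "\<pi> \<in> permutations_of_set L"
  shows "card {xs \<in> permutations_of_set (L \<union> T).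
      few_later_smaller d xs \<and> filter (\<lambda>x. x \<in> L) xs = \<pi>} = d ^ card T"
    (is "card (?A T) = _")
  using assms(1,4)
proof (induction T rule: finite_linorder_max_induct)
  case empty
  have "length \<pi> = d" "set \<pi> = L"
    using assms by (auto simp: permutations_of_set_def distinct_card)
  then have "?A {} = {\<pi>}"
    using assms(5) few_later_smaller_if_short[of \<pi> d]
    by (auto simp: permutations_of_set_def filter_id_conv)
  then show ?case by simp
next
  case (insert b T)
  have b: "b \<notin> L" "b \<notin> T" "\<forall>y\<in>L \<union> T. y < b"
    using insert by auto
  define m where "m = card (L \<union> T)"
  have "d \<le> m"
    using assms insert by (auto simp: m_def intro!: card_mono)
  \<comment> \<open>\<open>f (j, xs)\<close> inserts \<open>b\<close> so that exactly \<open>j\<close> entries stand behind it.\<close>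
  define f where "f = (\<lambda>(j, xs). take (m - j) xs @ b # drop (m - j) xs)"
  have len: "length xs = m" "b \<notin> set xs" "set xs = L \<union> T" if "xs \<in> ?A T" for xs
    using that b by (auto simp: m_def permutations_of_set_def simp flip: distinct_card)
  have inj: "inj_on f ({..<d} \<times> ?A T)"
  proof (rule inj_onI)
    fix p q
    assume p: "p \<in> {..<d} \<times> ?A T" and q: "q \<in> {..<d} \<times> ?A T" and f_eq: "f p = f q"
    obtain i xs where i: "i < d" "xs \<in> ?A T" and p_eq: "p = (i, xs)"
      using p by blast
    obtain j ys where j: "j < d" "ys \<in> ?A T" and q_eq: "q = (j, ys)"
      using q by blast
    have eq: "f (i, xs) = f (j, ys)"
      using f_eq by (simp add: p_eq q_eq)
    have "b \<notin> set (take (m - i) xs)" "b \<notin> set (drop (m - i) xs)"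
      using len(2)[OF i(2)] by (auto dest: in_set_takeD in_set_dropD)
    then have split: "take (m - i) xs = take (m - j) ys" "drop (m - i) xs = drop (m - j) ys"
      using eq by (auto simp: f_def append_Cons_eq_iff)
    from split have "xs = ys"
      by (metis append_take_drop_id)
    moreover have "m - i = m - j"
      using arg_cong[OF split(1), of length] len(1)[OF i(2)] len(1)[OF j(2)] by simp
    then have "i = j"
      using i(1) j(1) \<open>d \<le> m\<close> by simp
    ultimately show "p = q" by (simp add: p_eq q_eq)
  qed
  have "f ` ({..<d} \<times> ?A T) = ?A (insert b T)"
  proof (intro equalityI subsetI)
    fix zs assume "zs \<in> f ` ({..<d} \<times> ?A T)"
    then obtain j xs where j: "j < d" "xs \<in> ?A T" and zs: "zs = f (j, xs)"
      by auto
    define us vs where "us = take (m - j) xs" and "vs = drop (m - j) xs"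
    have xs: "xs = us @ vs" and "length vs = j"
      using len(1)[OF j(2)] j(1) \<open>d \<le> m\<close> by (simp_all add: us_def vs_def)
    moreover have "zs = us @ b # vs"
      by (simp add: zs f_def us_def vs_def)
    moreover have "\<forall>y\<in>set us \<union> set vs. y < b"
      using len(3)[OF j(2)] b(3) by (auto simp: xs)
    ultimately show "zs \<in> ?A (insert b T)"
      using j b by (auto simp: permutations_of_set_def few_later_smaller_insert_max)
  next
    fix zs assume zs: "zs \<in> ?A (insert b T)"
    then have "b \<in> set zs" by (auto simp: permutations_of_set_def)
    then obtain us vs where split: "zs = us @ b # vs"
      by (auto dest: split_list)
    have "distinct zs" "set zs = insert b (L \<union> T)"
      using zs by (auto simp: permutations_of_set_def)
    then have sets: "set us \<union> set vs = L \<union> T" "distinct (us @ vs)"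
      using b by (auto simp: split)
    then have few: "few_later_smaller d (us @ vs)" "length vs < d"
      using zs b few_later_smaller_insert_max[of us vs b d] by (auto simp: split)
    then have mem: "us @ vs \<in> ?A T"
      using zs b sets by (auto simp: permutations_of_set_def split)
    have "m - length vs = length us"
      using len(1)[OF mem] by simp
    then have "zs = f (length vs, us @ vs)"
      by (simp add: f_def split)
    then show "zs \<in> f ` ({..<d} \<times> ?A T)"
      using mem few(2) by blast
  qed
  then have "card (?A (insert b T)) = card ({..<d} \<times> ?A T)"
    using card_image[OF inj] by simp
  also have "\<dots> = d * d ^ card T"
    using insert by (simp add: card_cartesian_product)
  also have "\<dots> = d ^ card (insert b T)"
    using insert b by simp
  finally show ?case .
qed

lemma card_permutations_of_set_Cons:
  assumes "finite S" "S \<noteq> {}"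
  shows "card {xs \<in> permutations_of_set S. P xs} =
    (\<Sum>x\<in>S. card {ys \<in> permutations_of_set (S - {x}). P (x # ys)})"
proof -
  have "{xs \<in> permutations_of_set S. P xs} =
      (\<Union>x\<in>S. (#) x ` {ys \<in> permutations_of_set (S - {x}). P (x # ys)})"
    using permutations_of_set_nonempty[OF assms(2)] by auto
  also have "card \<dots> = (\<Sum>x\<in>S. card ((#) x ` {ys \<in> permutations_of_set (S - {x}). P (x # ys)}))"
    using assms(1) by (intro card_UN_disjoint) auto
  finally show ?thesis
    by (simp add: card_image)
qed

lemma length_filter_less_eq_rank:
  assumes "ys \<in> permutations_of_set (S - {x})"
  shows "length (filter (\<lambda>y. y < x) ys) = rank S x"
proof -
  have "{y \<in> S. y < x} = set (filter (\<lambda>y. y < x) ys)"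
    using assms by (auto simp: permutations_of_set_def)
  then show ?thesis
    using assms distinct_card[of "filter (\<lambda>y. y < x) ys"]
    by (simp add: rank_def permutations_of_set_def)
qed

text \<open>The entries below \<open>x\<close> are the \<open>d\<close> smallest of \<open>S\<close>, so that prescribing their pattern prescribes
the word that they form.\<close>

lemma card_few_later_smaller_order_iso:
  fixes S :: "'a::linorder set" and \<rho> :: "'b::linorder list"
  assumes "finite S" "x \<in> S" "rank S x = d" "distinct \<rho>" "length \<rho> = d"
  shows "card {ys \<in> permutations_of_set (S - {x}).
      few_later_smaller d ys \<and> order_iso (filter (\<lambda>y. y < x) ys) \<rho>} = d ^ (card S - 1 - d)"
proof -
  define L T where "L = {y \<in> S. y < x}" and "T = {y \<in> S. x < y}"
  have LT: "S - {x} = L \<union> T" "finite L" "finite T" "L \<inter> T = {}" "\<forall>x\<in>L. \<forall>y\<in>T. x < y"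
    and cardL: "card L = d"
    using assms by (auto simp: L_def T_def rank_def)
  have "card S - 1 = card L + card T"
    using LT assms(1,2) by (metis card_Diff_singleton card_Un_disjoint)
  then have cardT: "card T = card S - 1 - d"
    using cardL by simp
  obtain \<pi> where \<pi>: "\<pi> \<in> permutations_of_set L" "order_iso \<pi> \<rho>"
    and uniq: "\<And>ys. ys \<in> permutations_of_set L \<Longrightarrow> order_iso ys \<rho> \<Longrightarrow> ys = \<pi>"
    using ex1_permutation_order_iso[of L \<rho>] LT cardL assms by metis
  have "filter (\<lambda>y. y < x) ys = filter (\<lambda>y. y \<in> L) ys \<and> filter (\<lambda>y. y < x) ys \<in> permutations_of_set L"
    if "ys \<in> permutations_of_set (S - {x})" for ys
    using that by (auto simp: L_def permutations_of_set_def intro!: filter_cong)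
  then have "{ys \<in> permutations_of_set (S - {x}).
      few_later_smaller d ys \<and> order_iso (filter (\<lambda>y. y < x) ys) \<rho>} =
    {ys \<in> permutations_of_set (L \<union> T). few_later_smaller d ys \<and> filter (\<lambda>y. y \<in> L) ys = \<pi>}"
    using \<pi> uniq LT(1) by (smt (verit) Collect_cong)
  then show ?thesis
    using card_few_later_smaller[OF LT(3,2) cardL LT(5) \<pi>(1)] cardT by simp
qed

text \<open>The first entry of a permutation of \<open>S\<close> has as many later smaller entries as its rank in \<open>S\<close>, and
every rank below \<open>card S\<close> is attained once. The \<open>d\<close> smallest first entries are thus followed by a
shorter permutation of the same kind, the next one is the distinguished entry itself, and all
larger ones are impossible.\<close>

lemma card_single_excess:
  fixes S :: "'a::linorder set" and \<rho> :: "'b::linorder list"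
  assumes "finite S" "distinct \<rho>" "length \<rho> = d"
  shows "card {xs \<in> permutations_of_set S. single_excess d \<rho> xs} =
    (card S - d) * d ^ (card S - 1 - d)"
  using assms(1)
proof (induction "card S" arbitrary: S)
  case 0
  then show ?case by simp
next
  case (Suc n)
  \<comment> \<open>\<open>g i\<close> is the number of permutations whose first entry has rank \<open>i\<close>.\<close>
  define c where "c = (n - d) * d ^ (n - 1 - d)"
  define g where "g = (\<lambda>i. if i < d then c else if i = d then d ^ (n - d) else 0)"
  have summand: "card {ys \<in> permutations_of_set (S - {x}). single_excess d \<rho> (x # ys)} = g (rank S x)"
    if x: "x \<in> S" for x
  proof -
    have card: "card (S - {x}) = n"
      using Suc x by simp
    have eq: "{ys \<in> permutations_of_set (S - {x}). single_excess d \<rho> (x # ys)} =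
      {ys \<in> permutations_of_set (S - {x}). (rank S x < d \<and> single_excess d \<rho> ys) \<or>
        (rank S x = d \<and> few_later_smaller d ys \<and> order_iso (filter (\<lambda>y. y < x) ys) \<rho>)}"
      by (intro Collect_cong conj_cong refl) (simp add: length_filter_less_eq_rank)
    consider "rank S x < d" | "rank S x = d" | "rank S x > d"
      by linarith
    then show ?thesis
    proof cases
      case 1
      then show ?thesis
        using Suc.hyps(1)[of "S - {x}"] Suc.prems card unfolding eq by (simp add: g_def c_def)
    next
      case 2
      then show ?thesis
        using card_few_later_smaller_order_iso[OF Suc.prems x 2 assms(2,3)] Suc.hyps(2)[symmetric]
        unfolding eq by (simp add: g_def)
    next
      case 3
      then show ?thesis unfolding eq by (simp add: g_def)
    qed
  qed
  have "card {xs \<in> permutations_of_set S. single_excess d \<rho> xs} = (\<Sum>x\<in>S. g (rank S x))"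
    using card_permutations_of_set_Cons[of S "single_excess d \<rho>"] Suc summand by fastforce
  also have "\<dots> = (\<Sum>i<Suc n. g i)"
    using sum.reindex_bij_betw[OF bij_betw_rank[OF Suc.prems]] Suc.hyps(2) by metis
  also have "\<dots> = (Suc n - d) * d ^ (n - d)"
  proof (cases "n < d")
    case True
    then show ?thesis by (simp add: g_def c_def)
  next
    case False
    then obtain e where n: "n = d + e"
      by (metis le_add_diff_inverse not_less)
    have "(\<Sum>i<Suc (d + e). g i) = (\<Sum>i<Suc d. g i)"
      by (rule sum.mono_neutral_right) (auto simp: g_def)
    also have "\<dots> = d * c + d ^ e"
      by (simp add: g_def n)
    also have "\<dots> = Suc e * d ^ e"
      by (cases e) (simp_all add: c_def n algebra_simps)
    finally show ?thesis by (simp add: n)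
  qed
  finally show ?case
    using Suc.hyps(2)[symmetric] by simp
qed


section \<open>Occurrences led by their maximum\<close>

text \<open>The occurrences of all patterns of length \<open>d + 1\<close> that start with their largest letter, without
regard to which of these patterns it is.\<close>

definition max_led :: "nat \<Rightarrow> 'a::linorder list \<Rightarrow> nat list set" where
  "max_led d \<alpha> = {is. length is = Suc d \<and> sorted_wrt (<) is \<and> set is \<subseteq> {..<length \<alpha>} \<and>
    (\<forall>j\<in>set (tl is). \<alpha> ! j < \<alpha> ! hd is)}"

definition increasing_lists :: "nat \<Rightarrow> nat set \<Rightarrow> nat list set" where
  "increasing_lists d P = {js. length js = d \<and> sorted_wrt (<) js \<and> set js \<subseteq> P}"

lemma finite_increasing_lists: "finite P \<Longrightarrow> finite (increasing_lists d P)"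
  by (rule finite_subset[OF _ finite_lists_length_eq[of P d]]) (auto simp: increasing_lists_def)

lemma card_increasing_lists:
  assumes "finite P"
  shows "card (increasing_lists d P) = card P choose d"
proof -
  have "bij_betw set (increasing_lists d P) {B. B \<subseteq> P \<and> card B = d}"
    by (rule bij_betw_byWitness[where f' = sorted_list_of_set])
      (auto simp: increasing_lists_def strict_sorted_iff distinct_card finite_subset[OF _ assms]
        sorted_list_of_set.idem_if_sorted_distinct)
  then show ?thesis
    using n_subsets[OF assms] by (simp add: bij_betw_same_card)
qed

text \<open>An increasing list of positions in \<open>x # xs\<close> either avoids the first position, and is a shifted
list of positions in \<open>xs\<close>, or starts with it, and then \<open>x\<close> is the leading maximum.\<close>

lemma max_led_Cons:
  "max_led d (x # xs) = map Suc ` max_led d xs \<union>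
    (\<lambda>js. 0 # map Suc js) ` increasing_lists d {i. i < length xs \<and> xs ! i < x}"
proof -
  let ?P = "{i. i < length xs \<and> xs ! i < x}"
  have Suc_iff: "map Suc js \<in> max_led d (x # xs) \<longleftrightarrow> js \<in> max_led d xs" for js
    by (cases js) (auto simp: max_led_def sorted_wrt_map)
  have zero_iff: "0 # map Suc js \<in> max_led d (x # xs) \<longleftrightarrow> js \<in> increasing_lists d ?P" for js
    by (auto simp: max_led_def increasing_lists_def sorted_wrt_map)
  have form: "(\<exists>js. is = map Suc js) \<or> (\<exists>js. is = 0 # map Suc js)"
    if is_led: "is \<in> max_led d (x # xs)" for "is"
  proof -
    obtain i js where "is": "is = i # js"
      using is_led by (cases "is") (auto simp: max_led_def)
    then have "\<forall>j\<in>set js. i < j"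
      using is_led by (auto simp: max_led_def)
    then have js: "\<exists>ks. js = map Suc ks"
      unfolding ex_map_conv by (metis gr_implies_not0 not0_implies_Suc)
    then obtain ks where "js = map Suc ks" ..
    then show ?thesis
      by (cases i) (auto simp: "is" intro: exI[of _ "_ # ks"])
  qed
  show ?thesis
    using form Suc_iff zero_iff by blast
qed

lemma finite_max_led: "finite (max_led d \<alpha>)"
  by (rule finite_subset[OF _ finite_lists_length_eq[of "{..<length \<alpha>}" "Suc d"]])
    (auto simp: max_led_def)

lemma card_max_led_Cons:
  "card (max_led d (x # xs)) =
    card (max_led d xs) + (length (filter (\<lambda>y. y < x) xs) choose d)"
proof -
  let ?P = "{i. i < length xs \<and> xs ! i < x}"
  have "card (max_led d (x # xs)) = card (map Suc ` max_led d xs) +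
      card ((\<lambda>js. 0 # map Suc js) ` increasing_lists d ?P)"
    unfolding max_led_Cons
  proof (rule card_Un_disjoint)
    show "finite ((\<lambda>js. 0 # map Suc js) ` increasing_lists d ?P)"
      by (simp add: finite_increasing_lists)
  qed (auto simp: finite_max_led)
  also have "card (map Suc ` max_led d xs) = card (max_led d xs)"
    by (rule card_image) (simp add: inj_on_def)
  also have "card ((\<lambda>js. 0 # map Suc js) ` increasing_lists d ?P) = card ?P choose d"
    by (subst card_image) (simp_all add: inj_on_def card_increasing_lists)
  finally show ?thesis
    by (simp add: length_filter_conv_card)
qed

lemma max_led_eq_empty_iff: "max_led d \<alpha> = {} \<longleftrightarrow> few_later_smaller d \<alpha>"
proof -
  have "card (max_led d \<alpha>) = 0 \<longleftrightarrow> few_later_smaller d \<alpha>"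
  proof (induction \<alpha>)
    case Nil
    then show ?case by (auto simp: max_led_def)
  next
    case (Cons x xs)
    then show ?case by (auto simp: card_max_led_Cons binomial_eq_0_iff)
  qed
  then show ?thesis by (simp add: finite_max_led)
qed

lemma increasing_lists_eq_singleton:
  assumes "length (filter (\<lambda>y. y < x) xs) = d"
  shows "\<exists>js. increasing_lists d {i. i < length xs \<and> xs ! i < x} = {js} \<and>
    map ((!) xs) js = filter (\<lambda>y. y < x) xs"
proof -
  let ?P = "{i. i < length xs \<and> xs ! i < x}"
  let ?js = "filter (\<lambda>i. xs ! i < x) [0..<length xs]"
  have "map ((!) xs) ?js = filter (\<lambda>y. y < x) (map ((!) xs) [0..<length xs])"
    by (simp add: filter_map comp_def)
  then have map_js: "map ((!) xs) ?js = filter (\<lambda>y. y < x) xs"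
    by (simp add: map_nth)
  then have "length ?js = d"
    using assms by (metis length_map)
  then have mem: "?js \<in> increasing_lists d ?P"
    by (auto simp: increasing_lists_def intro: sorted_wrt_filter)
  have "card ?P = d"
    using assms by (simp add: length_filter_conv_card)
  then have "card (increasing_lists d ?P) = 1"
    by (simp add: card_increasing_lists)
  then have "increasing_lists d ?P = {?js}"
    using mem by (metis card_1_singletonE singletonD)
  then show ?thesis
    using map_js by blast
qed

text \<open>The first entry, with \<open>l\<close> later smaller entries, contributes \<open>l choose d\<close> occurrences. For
\<open>l < d\<close> this is none, and the only occurrence has to come from the rest; for \<open>l = d\<close> it is one, and
the rest must not contribute. For \<open>l > d\<close> it is at least two if \<open>d > 0\<close>; if \<open>d = 0\<close>, it is one,
but the nonempty rest contributes too.\<close>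

lemma max_led_singleton_iff:
  assumes "\<forall>z\<in>set \<rho>. z < m"
  shows "(\<exists>is. max_led d \<alpha> = {is} \<and> order_iso (map ((!) \<alpha>) is) (m # \<rho>)) \<longleftrightarrow>
    single_excess d \<rho> \<alpha>"
proof (induction \<alpha>)
  case Nil
  have "max_led d [] = {}"
    using max_led_eq_empty_iff[of d "[]"] by simp
  then show ?case
    by (metis insert_not_empty single_excess.simps(1))
next
  case (Cons x xs)
  let ?l = "length (filter (\<lambda>y. y < x) xs)"
  let ?P = "{i. i < length xs \<and> xs ! i < x}"
  have cardP: "card ?P = ?l"
    by (simp add: length_filter_conv_card)
  have map_Suc: "map ((!) (x # xs)) (map Suc js) = map ((!) xs) js" for js
    by simp
  consider "?l < d" | "?l = d" | "d < ?l"
    by linarith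
  then show ?case
  proof cases
    case 1
    have "increasing_lists d ?P = {}"
      using 1 cardP card_increasing_lists[of ?P d] finite_increasing_lists[of ?P d]
      by (simp add: binomial_eq_0)
    then have eq: "max_led d (x # xs) = map Suc ` max_led d xs"
      by (simp add: max_led_Cons)
    have "(\<exists>is. map Suc ` max_led d xs = {is} \<and> Q is) \<longleftrightarrow>
        (\<exists>is. max_led d xs = {is} \<and> Q (map Suc is))" for Q
    proof
      assume "\<exists>is. map Suc ` max_led d xs = {is} \<and> Q is"
      then obtain "is" where "is": "map Suc ` max_led d xs = {is}" "Q is"
        by blast
      then obtain js where js: "js \<in> max_led d xs" "is = map Suc js"
        by (metis imageE insertI1)
      have "ks = js" if "ks \<in> max_led d xs" for ks
        using that "is"(1) js(2) by (metis image_eqI inj_Suc inj_map_eq_map singletonD)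
      with js(1) have "max_led d xs = {js}"
        by blast
      moreover have "Q (map Suc js)"
        using "is"(2) unfolding js(2) .
      ultimately have "max_led d xs = {js} \<and> Q (map Suc js)" ..
      then show "\<exists>is. max_led d xs = {is} \<and> Q (map Suc is)" ..
    qed auto
    then show ?thesis
      using 1 Cons.IH by (simp only: eq map_Suc) simp
  next
    case 2
    obtain js where js: "increasing_lists d ?P = {js}"
      and map_js: "map ((!) xs) js = filter (\<lambda>y. y < x) xs"
      using increasing_lists_eq_singleton[OF 2] by blast
    have eq: "max_led d (x # xs) = insert (0 # map Suc js) (map Suc ` max_led d xs)"
      by (simp add: max_led_Cons js)
    have "0 # map Suc js \<notin> map Suc ` max_led d xs"
      by auto
    then have "(\<exists>is. max_led d (x # xs) = {is} \<and> Q is) \<longleftrightarrow>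
        max_led d xs = {} \<and> Q (0 # map Suc js)" for Q
      unfolding eq by (auto simp: insert_eq_iff doubleton_eq_iff)
    moreover have "map ((!) (x # xs)) (0 # map Suc js) = x # filter (\<lambda>y. y < x) xs"
      using map_js by (simp only: list.map map_Suc nth_Cons_0)
    moreover have "order_iso (x # filter (\<lambda>y. y < x) xs) (m # \<rho>) \<longleftrightarrow>
        order_iso (filter (\<lambda>y. y < x) xs) \<rho>"
      using assms by (intro order_iso_Cons_max) auto
    ultimately show ?thesis
      using 2 by (simp add: max_led_eq_empty_iff)
  next
    case 3
    have "card (max_led d (x # xs)) \<noteq> 1"
    proof (cases d)
      case 0
      then have "\<not> few_later_smaller d xs"
        using 3 by (cases xs) auto
      then have "card (max_led d xs) > 0"
        using finite_max_led[of d xs] max_led_eq_empty_iff[of d xs] by (simp add: card_gt_0_iff)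
      then show ?thesis
        using 0 by (simp add: card_max_led_Cons)
    next
      case (Suc e)
      obtain l where l: "?l = Suc l"
        using 3 by (cases ?l) auto
      have "l choose e > 0" "l choose Suc e > 0"
        using 3 Suc l by (simp_all add: zero_less_binomial)
      moreover have "?l choose d = (l choose e) + (l choose Suc e)"
        unfolding Suc l by simp
      ultimately have "?l choose d \<ge> 2"
        by linarith
      then show ?thesis
        by (simp add: card_max_led_Cons)
    qed
    then have "\<nexists>is. max_led d (x # xs) = {is}"
      by (simp add: card_1_singleton_iff)
    moreover have "\<not> single_excess d \<rho> (x # xs)"
      using 3 by simp
    ultimately show ?thesis
      by blast
  qed
qed


section \<open>Permutations with one occurrence of one pattern\<close>

lemma perms_fst_max_iff:
  "\<tau> \<in> perms_fst (Suc d) (Suc d) \<longleftrightarrow> (\<exists>\<rho>. \<tau> = Suc d # \<rho> \<and> \<rho> \<in> permutations_of_set {1..d})"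
proof (cases \<tau>)
  case Nil
  then show ?thesis
    by (simp add: perms_fst_def perms_def permutations_of_set_def)
next
  case (Cons m \<rho>)
  have "{1..Suc d} = insert (Suc d) {1..d}" "Suc d \<notin> {1..d}"
    by auto
  then show ?thesis
    unfolding Cons perms_fst_def perms_def permutations_of_set_def
    by (auto simp del: atLeastAtMost_iff simp: insert_ident)
qed

lemma occurrences_max_fst:
  assumes "length \<rho> = d" "\<forall>z\<in>set \<rho>. z < m"
  shows "occurrences (m # \<rho>) \<alpha> = {is \<in> max_led d \<alpha>. order_iso (map ((!) \<alpha>) is) (m # \<rho>)}"
proof -
  have "\<forall>j\<in>set (tl is). \<alpha> ! j < \<alpha> ! hd is" if occ: "is \<in> occurrences (m # \<rho>) \<alpha>" for "is"
  proof
    fix j assume j: "j \<in> set (tl is)"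
    obtain i js where "is": "is = i # js"
      using occ by (cases "is") (auto simp: occurrences_def)
    then obtain a where a: "a < length js" "j = js ! a"
      using j by (auto simp: in_set_conv_nth)
    have len: "length js = length \<rho>"
      using that "is" by (simp add: occurrences_def)
    have "\<alpha> ! (is ! Suc a) < \<alpha> ! (is ! 0) \<longleftrightarrow> (m # \<rho>) ! Suc a < (m # \<rho>) ! 0"
      using that a(1) len unfolding occurrences_def by fastforce
    then show "\<alpha> ! j < \<alpha> ! hd is"
      using a assms(2) len by (simp add: "is")
  qed
  then show ?thesis
    using assms(1) by (auto simp: occurrences_def max_led_def order_iso_def)
qed

text \<open>The tail of the occurrence has a unique standardisation over \<open>{1..d}\<close>; the leading maximum can only
correspond to the letter \<open>d + 1\<close>.\<close>

lemma ex1_pattern_of_max_led: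
  assumes "distinct \<alpha>" "is \<in> max_led d \<alpha>"
  shows "\<exists>!\<sigma>. \<sigma> \<in> perms_fst (Suc d) (Suc d) \<and> is \<in> occurrences \<sigma> \<alpha>"
proof -
  obtain i js where "is": "is = i # js"
    using assms(2) by (cases "is") (auto simp: max_led_def)
  have js: "length js = d" "distinct js" "set js \<subseteq> {..<length \<alpha>}" "\<forall>j\<in>set js. \<alpha> ! j < \<alpha> ! i"
    using assms(2) by (auto simp: "is" max_led_def strict_sorted_iff)
  have "distinct (map ((!) \<alpha>) js)"
    using js(2,3) inj_on_nth[OF assms(1), of "set js"] by (auto simp: distinct_map)
  then have ex1: "\<exists>!\<rho>. \<rho> \<in> permutations_of_set {1..d} \<and> order_iso \<rho> (map ((!) \<alpha>) js)"
    using js(1) by (intro ex1_permutation_order_iso) auto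
  have "is \<in> occurrences (Suc d # \<rho>) \<alpha> \<longleftrightarrow> order_iso \<rho> (map ((!) \<alpha>) js)"
    if \<rho>: "\<rho> \<in> permutations_of_set {1..d}" for \<rho>
  proof -
    have \<rho>_props: "length \<rho> = d" "\<forall>z\<in>set \<rho>. z < Suc d"
      using \<rho> by (auto simp: permutations_of_set_def simp flip: distinct_card)
    have "is \<in> occurrences (Suc d # \<rho>) \<alpha> \<longleftrightarrow> order_iso (\<alpha> ! i # map ((!) \<alpha>) js) (Suc d # \<rho>)"
      using assms(2) by (simp add: occurrences_max_fst[OF \<rho>_props] "is")
    also have "\<dots> \<longleftrightarrow> order_iso (map ((!) \<alpha>) js) \<rho>"
      using js(4) \<rho>_props(2) by (intro order_iso_Cons_max) auto
    also have "\<dots> \<longleftrightarrow> order_iso \<rho> (map ((!) \<alpha>) js)"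
      by (auto simp: order_iso_def)
    finally show ?thesis .
  qed
  then show ?thesis
    using ex1 by (auto simp: perms_fst_max_iff)
qed

text \<open>The occurrences of the individual patterns partition the set of all occurrences, so that the
conditions on the individual patterns say that this set has one element and where it lies.\<close>

lemma avoids_others_contains_once_iff:
  assumes "distinct \<alpha>" "\<tau> \<in> perms_fst (Suc d) (Suc d)"
  shows "(\<forall>\<sigma>\<in>perms_fst (Suc d) (Suc d) - {\<tau>}. avoids \<alpha> \<sigma>) \<and> contains_once \<alpha> \<tau> \<longleftrightarrow>
    (\<exists>is. max_led d \<alpha> = {is} \<and> is \<in> occurrences \<tau> \<alpha>)"
proof -
  have sub: "occurrences \<sigma> \<alpha> \<subseteq> max_led d \<alpha>" if \<sigma>: "\<sigma> \<in> perms_fst (Suc d) (Suc d)" for \<sigma>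
  proof -
    obtain \<rho> where \<rho>: "\<sigma> = Suc d # \<rho>" "\<rho> \<in> permutations_of_set {1..d}"
      using \<sigma> unfolding perms_fst_max_iff by blast
    then have "length \<rho> = d" "\<forall>z\<in>set \<rho>. z < Suc d"
      by (auto simp: permutations_of_set_def simp flip: distinct_card)
    then show ?thesis
      by (auto simp: \<rho>(1) occurrences_max_fst)
  qed
  note ex1 = ex1_pattern_of_max_led[OF assms(1)]
  show ?thesis
  proof
    assume *: "(\<forall>\<sigma>\<in>perms_fst (Suc d) (Suc d) - {\<tau>}. avoids \<alpha> \<sigma>) \<and> contains_once \<alpha> \<tau>"
    then obtain "is" where occ: "occurrences \<tau> \<alpha> = {is}"
      by (auto simp: contains_once_def)
    have "max_led d \<alpha> \<subseteq> occurrences \<tau> \<alpha>"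
    proof
      fix js assume "js \<in> max_led d \<alpha>"
      then obtain \<sigma> where "\<sigma> \<in> perms_fst (Suc d) (Suc d)" "js \<in> occurrences \<sigma> \<alpha>"
        using ex1 by blast
      then show "js \<in> occurrences \<tau> \<alpha>"
        using * by (auto simp: avoids_def)
    qed
    then have "max_led d \<alpha> = {is}"
      using sub[OF assms(2)] occ by auto
    then show "\<exists>is. max_led d \<alpha> = {is} \<and> is \<in> occurrences \<tau> \<alpha>"
      using occ by auto
  next
    assume "\<exists>is. max_led d \<alpha> = {is} \<and> is \<in> occurrences \<tau> \<alpha>"
    then obtain "is" where "is": "max_led d \<alpha> = {is}" "is \<in> occurrences \<tau> \<alpha>"
      by blast
    have "occurrences \<sigma> \<alpha> = {}" if \<sigma>: "\<sigma> \<in> perms_fst (Suc d) (Suc d)" "\<sigma> \<noteq> \<tau>" for \<sigma>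
    proof -
      have "is \<notin> occurrences \<sigma> \<alpha>"
        using ex1[of "is" d] "is" \<sigma> assms(2) by (metis singletonI)
      then show ?thesis
        using sub[OF \<sigma>(1)] unfolding "is"(1) by auto
    qed
    moreover have "occurrences \<tau> \<alpha> = {is}"
      using sub[OF assms(2)] "is" by auto
    ultimately show
      "(\<forall>\<sigma>\<in>perms_fst (Suc d) (Suc d) - {\<tau>}. avoids \<alpha> \<sigma>) \<and> contains_once \<alpha> \<tau>"
      by (auto simp: avoids_def contains_once_def)
  qed
qed

theorem corollary3p1:
  fixes k n :: nat and \<tau> :: "nat list"
  assumes "1 \<le> k" and "k \<le> n" and "\<tau> \<in> perms_fst k k"
  shows "card (avoid_except_once n (perms_fst k k) \<tau>) = (n + 1 - k) * (k - 1) ^ (n - k)"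
proof -
  obtain d where k: "k = Suc d"
    using assms(1) by (cases k) auto
  obtain \<rho> where \<tau>: "\<tau> = Suc d # \<rho>" and \<rho>: "\<rho> \<in> permutations_of_set {1..d}"
    using assms(3) by (auto simp: k perms_fst_max_iff)
  have \<rho>_props: "length \<rho> = d" "distinct \<rho>" "\<forall>z\<in>set \<rho>. z < Suc d"
    using \<rho> by (auto simp: permutations_of_set_def simp flip: distinct_card)
  have "(\<forall>\<sigma>\<in>perms_fst k k - {\<tau>}. avoids \<alpha> \<sigma>) \<and> contains_once \<alpha> \<tau> \<longleftrightarrow> single_excess d \<rho> \<alpha>"
    if "\<alpha> \<in> permutations_of_set {1..n}" for \<alpha>
  proof -
    have "distinct \<alpha>"
      using that by (simp add: permutations_of_set_def)
    from avoids_others_contains_once_iff[OF this assms(3)[unfolded k]] show ?thesis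
      unfolding k \<tau> max_led_singleton_iff[OF \<rho>_props(3), symmetric]
        occurrences_max_fst[OF \<rho>_props(1,3)] by auto
  qed
  then have "avoid_except_once n (perms_fst k k) \<tau> =
      {\<alpha> \<in> permutations_of_set {1..n}. single_excess d \<rho> \<alpha>}"
    unfolding avoid_except_once_def perms_def by blast
  then show ?thesis
    using card_single_excess[of "{1..n}" \<rho> d] \<rho>_props by (simp add: k)
qed

end
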